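(* Let $\mathcal V=\{z\in\mathbb D^3: z_1+z_2+z_3=0\}$. Then $\mathcal V$ does not have the polynomial extension property with respect to $\mathbb D^3$, although for each $r=1,2,3$ there are a domain $U_r\subseteq\mathbb D^2$ and a holomorphic function $h_r:U_r\to\mathbb D$ such that $$\mathcal V=\{(z_1,z_2,h_3(z_1,z_2)):(z_1,z_2)\in U_3\}=\{(z_1,h_2(z_1,z_3),z_3):(z_1,z_3)\in U_2\}=\{(h_1(z_2,z_3),z_2,z_3):(z_2,z_3)\in U_1\}.$$
   Context: $\mathbb D$ is the open unit disk in $\mathbb C$. A non-empty set $\mathcal V\subseteq\mathbb D^3$ has the polynomial extension property with respect to $\mathbb D^3$ if for every polynomial $p\in\mathbb C[z_1,z_2,z_3]$ there is a bounded holomorphic function $\phi$ on $\mathbb D^3$ with $\phi|_{\mathcal V}=p|_{\mathcal V}$ and $\sup_{\mathbb D^3}|\phi|=\sup_{\mathcal V}|p|$. *)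

theory Defs
  imports "HOL-Analysis.Analysis" "HOL-Library.Poly_Mapping"
begin

definition polydisc :: "(complex ^ 'n) set" where
  "polydisc = {z. \<forall>i. cmod (z $ i) < 1}"

definition holomorphic_several_on :: "(complex ^ 'n \<Rightarrow> complex) \<Rightarrow> (complex ^ 'n) set \<Rightarrow> bool" where
  "holomorphic_several_on f S \<longleftrightarrow> open S \<and>
     (\<forall>z\<in>S. \<exists>f'. (f has_derivative f') (at z) \<and> (\<forall>c v. f' (c *s v) = c * f' v))"

definition domain_several :: "(complex ^ 'n) set \<Rightarrow> bool" where
  "domain_several U \<longleftrightarrow> open U \<and> connected U \<and> U \<noteq> {}"

(* Finitely supported maps from exponent vectors to coefficients; the ring operations of
   Poly_Mapping make this the polynomial ring in the variables indexed by 'n. *)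
type_synonym 'n cpoly = "('n \<Rightarrow>\<^sub>0 nat) \<Rightarrow>\<^sub>0 complex"

definition eval_cpoly :: "'n cpoly \<Rightarrow> complex ^ 'n \<Rightarrow> complex" where
  "eval_cpoly p z =
     (\<Sum>m\<in>Poly_Mapping.keys p. Poly_Mapping.lookup p m * (\<Prod>i\<in>UNIV. (z $ i) ^ Poly_Mapping.lookup m i))"

(* Intended for non-empty V contained in polydisc. Both suprema are then over non-empty sets of
   reals that are bounded above, so Sup on the reals is the genuine supremum. *)
definition polynomial_extension_property :: "(complex ^ 3) set \<Rightarrow> bool" where
  "polynomial_extension_property V \<longleftrightarrow>
     (\<forall>p :: 3 cpoly. \<exists>\<phi>. holomorphic_several_on \<phi> polydisc \<and> bounded (\<phi> ` polydisc) \<and>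
        (\<forall>z\<in>V. \<phi> z = eval_cpoly p z) \<and>
        (SUP z\<in>polydisc. cmod (\<phi> z)) = (SUP z\<in>V. cmod (eval_cpoly p z)))"

end

theory Submission
  imports Defs "HOL-Complex_Analysis.Conformal_Mappings"
begin

text \<open>
  The polynomial \<open>z\<^sub>1\<^sup>2 + z\<^sub>2\<^sup>2 + z\<^sub>3\<^sup>2\<close> has no extension of the same norm. On \<open>V\<close> it is bounded by 2. For an
  extension \<open>\<phi>\<close> bounded by 2, let \<open>q v\<close> be the second derivative of \<open>t \<mapsto> \<phi> (t v)\<close> at 0. Cauchy's
  estimate gives \<open>\<bar>q v\<bar> \<le> 4\<close> for \<open>v\<close> in the closed polydisc, \<open>q\<close> obeys the parallelogram law, and
  \<open>q (e\<^sub>i - e\<^sub>j) = 4\<close> since \<open>e\<^sub>i - e\<^sub>j\<close> lies in the plane of \<open>V\<close>. These force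
  \<open>3 (q (1, 1, -1) + q (1, -1, 1) + q (-1, 1, 1)) = 48 + q (1, 1, 1)\<close>, where the left side is at most
  36 and the right side at least 44 in real part.
\<close>

section \<open>Restriction of holomorphic functions to complex lines\<close>

lemma bounded_linear_scaleC_vec: "bounded_linear (\<lambda>s. s *s (v :: complex ^ 'n))"
  unfolding linear_conv_bounded_linear[symmetric]
  by (rule linearI) (vector algebra_simps, simp add: vec_eq_iff)

lemma norm_scaleC_vec: "norm (s *s (v :: complex ^ 'n)) = cmod s * norm v"
  by (simp add: norm_vec_def norm_mult L2_set_right_distrib)

lemma open_polydisc: "open (polydisc :: (complex ^ 'n) set)"
proof -
  have "polydisc = (\<Inter>i. {z :: complex ^ 'n. cmod (z $ i) < 1})"
    by (auto simp: polydisc_def)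
  moreover have "open (\<Inter>i. {z :: complex ^ 'n. cmod (z $ i) < 1})"
    by (intro open_INT ballI open_Collect_less continuous_intros) simp
  ultimately show ?thesis by simp
qed

text \<open>Chain rule: complex homogeneity of the derivative \<open>f'\<close> turns
  \<open>s \<mapsto> f' (s *s v)\<close> into multiplication by the number \<open>f' v\<close>. This
  reduces all later arguments to one complex variable.\<close>

lemma holomorphic_on_line:
  assumes "holomorphic_several_on \<phi> S" "\<And>s. s \<in> A \<Longrightarrow> a + s *s v \<in> S"
  shows "(\<lambda>s. \<phi> (a + s *s v)) holomorphic_on A"
  unfolding holomorphic_on_def
proof
  fix s assume "s \<in> A"
  then obtain f' where f': "(\<phi> has_derivative f') (at (a + s *s v))"
      "\<And>c w. f' (c *s w) = c * f' w"
    using assms unfolding holomorphic_several_on_def by meson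
  have "((\<lambda>s. a + s *s v) has_derivative (\<lambda>s. s *s v)) (at s within A)"
    using has_derivative_add[OF has_derivative_const
        bounded_linear_imp_has_derivative[OF bounded_linear_scaleC_vec]] by simp
  from has_derivative_compose[OF this f'(1)]
  have "((\<lambda>s. \<phi> (a + s *s v)) has_field_derivative f' v) (at s within A)"
    by (simp add: has_field_derivative_def f'(2) mult.commute[of _ "f' v"])
  then show "(\<lambda>s. \<phi> (a + s *s v)) field_differentiable at s within A"
    unfolding field_differentiable_def by blast
qed

section \<open>Even holomorphic functions of one variable\<close>

text \<open>Differentiating \<open>F (- s) = F s\<close> at 0 gives \<open>G 0 = - G 0\<close>, so
  after one factor \<open>s\<close> has been split off the quotient \<open>G\<close> vanishes at 0
  again and a second factor can be split off.\<close>

lemma holomorphic_even_factor: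
  assumes hol: "F holomorphic_on ball 0 R" and "0 < R" and "F 0 = 0"
    and even: "\<And>s. F (- s) = F s"
  obtains H where "H holomorphic_on ball 0 R" "\<And>s. cmod s < R \<Longrightarrow> F s = s\<^sup>2 * H s"
proof -
  obtain G where G: "G holomorphic_on ball 0 R" "\<And>s. cmod s < R \<Longrightarrow> F s = s * G s"
      "deriv F 0 = G 0"
    using Schwarz3[OF hol \<open>F 0 = 0\<close>] by metis
  have d: "(F has_field_derivative G 0) (at 0)"
    using holomorphic_derivI[OF hol open_ball, of 0] G(3) \<open>0 < R\<close> by simp
  then have "((\<lambda>s. F (- s)) has_field_derivative - G 0) (at 0)"
    using DERIV_chain2[of F "G 0" uminus 0 "-1" UNIV] DERIV_minus[OF DERIV_ident, of 0 UNIV] by simp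
  with d have "G 0 = 0"
    using DERIV_unique[OF d, of "- G 0"] by (simp add: even)
  then obtain H where "H holomorphic_on ball 0 R" "\<And>s. cmod s < R \<Longrightarrow> G s = s * H s"
    using Schwarz3[OF G(1)] by metis
  with G(2) show ?thesis
    by (intro that[of H]) (auto simp: power2_eq_square mult.assoc)
qed

text \<open>The bound holds for \<open>H\<close> on the circle of radius \<open>r\<close>, and the
  maximum principle carries it inside. At \<open>s = 0\<close> this is Cauchy's estimate for the
  second coefficient; at other points it transports smallness inwards from the circle.\<close>

lemma holomorphic_quotient_bound:
  assumes hol: "H holomorphic_on ball 0 R" and F: "\<And>s. cmod s < R \<Longrightarrow> F s = s\<^sup>2 * H s"
    and r: "0 < r" "r < R" and bd: "\<And>s. cmod s = r \<Longrightarrow> cmod (F s) \<le> \<epsilon>"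
    and "cmod s \<le> r"
  shows "cmod (H s) \<le> \<epsilon> / r\<^sup>2"
proof (rule maximum_modulus_frontier[of H "cball 0 r"])
  show "H holomorphic_on interior (cball 0 r)"
    using r by (intro holomorphic_on_subset[OF hol]) auto
  show "continuous_on (closure (cball 0 r)) H"
    using r by (intro holomorphic_on_imp_continuous_on holomorphic_on_subset[OF hol]) auto
  fix z assume "z \<in> frontier (cball (0 :: complex) r)"
  then have z: "cmod z = r" using r by (simp add: frontier_cball)
  with bd[OF z] F[of z] r show "cmod (H z) \<le> \<epsilon> / r\<^sup>2"
    by (simp add: norm_mult norm_power field_simps)
qed (use assms in auto)

section \<open>Second differences and the quadratic part at the origin\<close>

text \<open>The symmetric form is even in \<open>x\<close>: linear terms cancel, and along a line
  through \<open>z\<close> the result is divisible by the square of the parameter.\<close>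

definition second_difference :: "('a::ab_group_add \<Rightarrow> complex) \<Rightarrow> 'a \<Rightarrow> 'a \<Rightarrow> complex" where
  "second_difference \<phi> z x = \<phi> (z + x) + \<phi> (z - x) - 2 * \<phi> z"

lemma second_difference_0 [simp]: "second_difference \<phi> z 0 = 0"
  by (simp add: second_difference_def)

lemma second_difference_minus [simp]: "second_difference \<phi> z (- x) = second_difference \<phi> z x"
  by (simp add: second_difference_def)

text \<open>Both sides contain the values of \<open>\<phi>\<close> at the four points
  \<open>\<plusminus>v \<plusminus> w\<close>, minus twice those at \<open>\<plusminus>v\<close>.
  Scaled and passed to the limit, this becomes the parallelogram law.\<close>

lemma second_difference_sum:
  "second_difference \<phi> v w + second_difference \<phi> (- v) w
     = second_difference \<phi> 0 (v + w) + second_difference \<phi> 0 (v - w) - 2 * second_difference \<phi> 0 v"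
  by (simp add: second_difference_def add.commute algebra_simps)

lemma holomorphic_second_difference:
  assumes "holomorphic_several_on \<phi> S" "\<And>s. cmod s < R \<Longrightarrow> a + s *s v \<in> S"
  shows "(\<lambda>s. second_difference \<phi> a (s *s v)) holomorphic_on ball 0 R"
proof -
  have "(\<lambda>s. \<phi> (a + s *s v)) holomorphic_on ball 0 R"
    "(\<lambda>s. \<phi> (a + s *s (- v))) holomorphic_on ball 0 R"
    using assms(2)[of "- _"] by (intro holomorphic_on_line[OF assms(1)] assms(2); simp)+
  then show ?thesis
    unfolding second_difference_def by (auto intro!: holomorphic_intros)
qed

text \<open>For \<open>\<phi>\<close> holomorphic near 0 this is twice the degree-two homogeneous
  Taylor part of \<open>\<phi>\<close> at \<open>v\<close>. A limit of second differences avoids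
  iterated partial derivatives. \<open>Lim\<close> is total; that the limit exists is shown in
  \<open>second_coeff_tendsto\<close>.\<close>

definition second_coeff :: "(complex ^ 'n \<Rightarrow> complex) \<Rightarrow> complex ^ 'n \<Rightarrow> complex" where
  "second_coeff \<phi> v = Lim (at 0) (\<lambda>t. second_difference \<phi> 0 (t *s v) / t\<^sup>2)"

text \<open>The second difference along the line is even and vanishes at 0, so
  \<open>holomorphic_even_factor\<close> applies. The same \<open>H\<close> gives both the limit and
  the circle estimate.\<close>

lemma second_difference_factor:
  assumes hol: "holomorphic_several_on \<phi> S" and "0 < R" and S: "\<And>s. cmod s < R \<Longrightarrow> s *s v \<in> S"
  obtains H where "H holomorphic_on ball 0 R"
    "\<And>s. cmod s < R \<Longrightarrow> second_difference \<phi> 0 (s *s v) = s\<^sup>2 * H s"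
    "second_coeff \<phi> v = H 0"
    "((\<lambda>t. second_difference \<phi> 0 (t *s v) / t\<^sup>2) \<longlongrightarrow> H 0) (at 0)"
proof -
  have "(\<lambda>s. second_difference \<phi> 0 (s *s v)) holomorphic_on ball 0 R"
    using S by (intro holomorphic_second_difference[OF hol]) simp
  then obtain H where H: "H holomorphic_on ball 0 R"
    "\<And>s. cmod s < R \<Longrightarrow> second_difference \<phi> 0 (s *s v) = s\<^sup>2 * H s"
    by (rule holomorphic_even_factor) (use \<open>0 < R\<close> in auto)
  have "isCont H 0"
    using holomorphic_on_imp_continuous_on[OF H(1)] \<open>0 < R\<close>
    by (simp add: continuous_on_eq_continuous_at)
  then have "(H \<longlongrightarrow> H 0) (at 0)" by (simp add: isCont_def)
  moreover have "\<forall>\<^sub>F t in at 0. H t = second_difference \<phi> 0 (t *s v) / t\<^sup>2"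
    unfolding eventually_at using \<open>0 < R\<close> H(2) by (intro exI[of _ R]) auto
  ultimately have lim: "((\<lambda>t. second_difference \<phi> 0 (t *s v) / t\<^sup>2) \<longlongrightarrow> H 0) (at 0)"
    by (rule Lim_transform_eventually)
  then have "second_coeff \<phi> v = H 0"
    unfolding second_coeff_def by (intro tendsto_Lim) auto
  with H lim show ?thesis using that by blast
qed

lemma open_scaleC_vec:
  fixes S :: "(complex ^ 'n) set"
  assumes "open S" "0 \<in> S"
  obtains R where "0 < R" "\<And>s. cmod s < R \<Longrightarrow> s *s v \<in> S"
proof -
  obtain e where e: "0 < e" "ball 0 e \<subseteq> S"
    using assms open_contains_ball by blast
  have "s *s v \<in> S" if "cmod s < e / (norm v + 1)" for s
  proof -
    have "norm (s *s v) \<le> cmod s * (norm v + 1)"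
      by (simp add: norm_scaleC_vec mult_left_mono)
    also have "\<dots> < e" using that by (simp add: pos_less_divide_eq add_nonneg_pos)
    finally show ?thesis using e by auto
  qed
  with e show ?thesis by (intro that[of "e / (norm v + 1)"]) (auto simp: add_nonneg_pos)
qed

lemma second_coeff_tendsto:
  assumes hol: "holomorphic_several_on \<phi> S" and "0 \<in> S"
  shows "((\<lambda>t. second_difference \<phi> 0 (t *s v) / t\<^sup>2) \<longlongrightarrow> second_coeff \<phi> v) (at 0)"
proof -
  have "open S" using hol by (simp add: holomorphic_several_on_def)
  then obtain R where "0 < R" "\<And>s. cmod s < R \<Longrightarrow> s *s v \<in> S"
    using open_scaleC_vec \<open>0 \<in> S\<close> by blast
  then show ?thesis using second_difference_factor[OF hol] by metis
qed

text \<open>Divided by \<open>s\<^sup>2\<close>, the difference of the second differences at \<open>t v\<close> and at \<open>0\<close> is holomorphic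
  in \<open>s\<close>, so its smallness on a fixed circle, which is mere continuity of \<open>\<phi>\<close>, persists at \<open>s = t\<close>.\<close>

lemma second_difference_moving_base:
  fixes \<phi> :: "complex ^ 'n \<Rightarrow> complex"
  assumes hol: "holomorphic_several_on \<phi> S" and "0 \<in> S"
  shows "((\<lambda>t. second_difference \<phi> (t *s v) (t *s w) / t\<^sup>2) \<longlongrightarrow> second_coeff \<phi> w) (at 0)"
proof -
  have "open S" using hol by (simp add: holomorphic_several_on_def)
  then obtain \<rho> where \<rho>: "0 < \<rho>" "cball 0 \<rho> \<subseteq> S"
    using \<open>0 \<in> S\<close> open_contains_cball by blast
  have "continuous_on (cball 0 \<rho>) \<phi>"
    using hol \<rho>(2) unfolding holomorphic_several_on_def
    by (metis continuous_at_imp_continuous_on has_derivative_continuous subsetD)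
  then have uc: "uniformly_continuous_on (cball 0 \<rho>) \<phi>"
    by (rule compact_uniformly_continuous) simp
  \<comment> \<open>The summand 1 keeps \<open>N\<close> positive for \<open>v = w = 0\<close>. With
    \<open>R = \<rho> / N\<close>, all points \<open>t *s v + s *s w\<close> with \<open>t\<close>,
    \<open>s\<close> below \<open>R\<close> stay in the ball of uniform continuity. The radius
    \<open>r\<close> does not depend on the later \<open>e\<close>.\<close>
  define N where "N = norm v + norm w + 1"
  have N: "0 < N" by (simp add: N_def add_nonneg_pos)
  define R where "R = \<rho> / N"
  define r where "r = R / 2"
  have R: "0 < R" "0 < r" "r < R" using N \<rho> by (simp_all add: R_def r_def field_simps)
  have mem: "t *s v + s *s w \<in> cball 0 \<rho>" if "cmod t < R" "cmod s < R" for s t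
  proof -
    have "norm (t *s v + s *s w) \<le> cmod t * norm v + cmod s * norm w"
      by (metis norm_scaleC_vec norm_triangle_ineq)
    also have "\<dots> \<le> R * norm v + R * norm w"
      using that by (intro add_mono mult_right_mono) auto
    also have "\<dots> \<le> R * N" using R by (simp add: N_def algebra_simps)
    finally show ?thesis using N by (simp add: R_def)
  qed
  define D where "D t = second_difference \<phi> (t *s v) (t *s w) - second_difference \<phi> 0 (t *s w)" for t
  have "((\<lambda>t. D t / t\<^sup>2) \<longlongrightarrow> 0) (at 0)"
    unfolding tendsto_iff
  proof (intro allI impI)
    fix e :: real assume "0 < e"
    \<comment> \<open>\<open>?F\<close> below is a combination of differences with total weight 4,
      so the quotient is at most \<open>4 * \<eta> / r\<^sup>2 = 4 * e / 5\<close>.\<close>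
    define \<eta> where "\<eta> = e * r\<^sup>2 / 5"
    have "0 < \<eta>" using \<open>0 < e\<close> R by (simp add: \<eta>_def)
    then obtain \<delta> where \<delta>: "0 < \<delta>"
        "\<And>x y. x \<in> cball 0 \<rho> \<Longrightarrow> y \<in> cball 0 \<rho> \<Longrightarrow> dist y x < \<delta> \<Longrightarrow> cmod (\<phi> y - \<phi> x) < \<eta>"
      using uc unfolding uniformly_continuous_on_def dist_norm[of "\<phi> _"] by metis
    \<comment> \<open>The bound \<open>r\<close> puts \<open>t\<close> inside the circle, so that
      \<open>s = t\<close> is allowed at the end; \<open>\<delta> / N\<close> makes the shift
      \<open>t *s v\<close> shorter than \<open>\<delta>\<close>.\<close>
    have "dist (D t / t\<^sup>2) 0 < e" if "t \<noteq> 0" and t: "cmod t < min r (\<delta> / N)" for t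
    proof -
      have tr: "cmod t < r" "cmod t < R" using t R by auto
      have "norm (t *s v) \<le> cmod t * N"
        by (simp add: norm_scaleC_vec N_def mult_left_mono)
      also have "\<dots> < \<delta>" using t N by (simp add: pos_less_divide_eq)
      finally have t\<delta>: "norm (t *s v) < \<delta>" .
      have small: "cmod (\<phi> (t *s v + s *s w) - \<phi> (s *s w)) < \<eta>" if "cmod s < R" for s
        using mem[OF tr(2) that] mem[of 0 s] that R t\<delta> by (intro \<delta>) (auto simp: dist_norm)
      \<comment> \<open>Here \<open>t\<close> is frozen and only \<open>s\<close> varies;
        \<open>D t\<close> is the value of \<open>?F\<close> at \<open>s = t\<close>.\<close>
      let ?F = "\<lambda>s. second_difference \<phi> (t *s v) (s *s w) - second_difference \<phi> 0 (s *s w)"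
      have "?F holomorphic_on ball 0 R"
        using mem[OF tr(2)] mem[of 0] R \<rho>
        by (intro holomorphic_on_diff holomorphic_second_difference[OF hol]) fastforce+
      then obtain H where H: "H holomorphic_on ball 0 R" "\<And>s. cmod s < R \<Longrightarrow> ?F s = s\<^sup>2 * H s"
        by (rule holomorphic_even_factor) (use R in auto)
      have "cmod (?F s) \<le> 4 * \<eta>" if "cmod s = r" for s
      proof -
        have s: "cmod s < R" "cmod (- s) < R" using that R by auto
        \<comment> \<open>Regrouped by the points \<open>s *s w\<close>, \<open>- s *s w\<close> and
          0, each value is compared with its shift by \<open>t *s v\<close>, so \<open>small\<close>
          applies to every bracket.\<close>
        have "?F s = (\<phi> (t *s v + s *s w) - \<phi> (s *s w)) + (\<phi> (t *s v + (- s) *s w) - \<phi> ((- s) *s w))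
             - 2 * (\<phi> (t *s v + 0 *s w) - \<phi> (0 *s w))"
          by (simp add: second_difference_def)
        also have "cmod \<dots> \<le> cmod (\<phi> (t *s v + s *s w) - \<phi> (s *s w))
            + cmod (\<phi> (t *s v + (- s) *s w) - \<phi> ((- s) *s w))
            + 2 * cmod (\<phi> (t *s v + 0 *s w) - \<phi> (0 *s w))"
          by (intro order.trans[OF norm_triangle_ineq4] add_mono norm_triangle_ineq) (simp only: norm_mult norm_numeral)
        also have "\<dots> \<le> 4 * \<eta>"
          using small[OF s(1)] small[OF s(2)] small[of 0] R by simp
        finally show ?thesis .
      qed
      from holomorphic_quotient_bound[OF H R(2,3) this, of t] tr
      have "cmod (H t) \<le> 4 * \<eta> / r\<^sup>2" by auto
      also have "\<dots> < e" using R \<open>0 < e\<close> by (simp add: \<eta>_def)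
      finally show ?thesis using H(2)[OF tr(2)] \<open>t \<noteq> 0\<close> by (simp add: D_def)
    qed
    then show "\<forall>\<^sub>F t in at 0. dist (D t / t\<^sup>2) 0 < e"
      unfolding eventually_at using R \<delta> N by (intro exI[of _ "min r (\<delta> / N)"]) auto
  qed
  from tendsto_add[OF this second_coeff_tendsto[OF assms, of w]]
  show ?thesis by (simp add: D_def diff_divide_distrib)
qed

text \<open>Apply \<open>second_difference_sum\<close> to \<open>t *s v\<close> and
  \<open>t *s w\<close> and divide by \<open>t\<^sup>2\<close>. As \<open>t\<close> tends to 0, both
  terms with moving base \<open>\<plusminus>t *s v\<close> tend to
  \<open>second_coeff \<phi> w\<close>.\<close>

lemma second_coeff_parallelogram:
  assumes "holomorphic_several_on \<phi> S" "0 \<in> S"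
  shows "second_coeff \<phi> (v + w) + second_coeff \<phi> (v - w) = 2 * second_coeff \<phi> v + 2 * second_coeff \<phi> w"
proof -
  let ?\<Delta> = "second_difference \<phi>"
  note tends = second_coeff_tendsto[OF assms] second_difference_moving_base[OF assms]
  have "((\<lambda>t. ?\<Delta> (t *s v) (t *s w) / t\<^sup>2 + ?\<Delta> (t *s (- v)) (t *s w) / t\<^sup>2)
          \<longlongrightarrow> second_coeff \<phi> w + second_coeff \<phi> w) (at 0)"
    by (intro tendsto_intros tends)
  moreover have "?\<Delta> (t *s v) (t *s w) / t\<^sup>2 + ?\<Delta> (t *s (- v)) (t *s w) / t\<^sup>2
      = ?\<Delta> 0 (t *s (v + w)) / t\<^sup>2 + ?\<Delta> 0 (t *s (v - w)) / t\<^sup>2 - 2 * (?\<Delta> 0 (t *s v) / t\<^sup>2)" for t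
    using second_difference_sum[of \<phi> "t *s v" "t *s w"]
    by (simp add: vector_add_ldistrib vector_ssub_ldistrib flip: add_divide_distrib diff_divide_distrib)
  moreover have "((\<lambda>t. ?\<Delta> 0 (t *s (v + w)) / t\<^sup>2 + ?\<Delta> 0 (t *s (v - w)) / t\<^sup>2 - 2 * (?\<Delta> 0 (t *s v) / t\<^sup>2))
     \<longlongrightarrow> second_coeff \<phi> (v + w) + second_coeff \<phi> (v - w) - 2 * second_coeff \<phi> v) (at 0)"
    by (intro tendsto_intros tends)
  ultimately have "second_coeff \<phi> w + second_coeff \<phi> w
      = second_coeff \<phi> (v + w) + second_coeff \<phi> (v - w) - 2 * second_coeff \<phi> v"
    using tendsto_unique[OF trivial_limit_at] by (simp only:) blast
  then show ?thesis by (simp add: algebra_simps)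
qed

lemma second_coeff_minus: "second_coeff \<phi> (- v) = second_coeff \<phi> v"
  by (simp add: second_coeff_def)

section \<open>Estimates and prescribed values of the quadratic part\<close>

lemma scaleC_vec_in_polydisc:
  assumes "\<And>i. cmod (v $ i) \<le> 1" "cmod s < 1"
  shows "s *s v \<in> polydisc"
  using assms by (auto simp: polydisc_def norm_mult intro: order.strict_trans1[OF mult_left_le])

text \<open>Since \<open>\<phi> 0 = 0\<close>, only two values of \<open>\<phi>\<close> remain in
  the second difference, which gives \<open>2 * M\<close> on the circle of radius
  \<open>r\<close>.\<close>

lemma second_coeff_bound:
  assumes hol: "holomorphic_several_on \<phi> polydisc" and M: "\<And>z. z \<in> polydisc \<Longrightarrow> cmod (\<phi> z) \<le> M"
    and "\<phi> 0 = 0" and v: "\<And>i. cmod (v $ i) \<le> 1" and r: "0 < r" "r < 1"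
  shows "cmod (second_coeff \<phi> v) \<le> 2 * M / r\<^sup>2"
proof -
  note mem = scaleC_vec_in_polydisc[of v, OF v]
  obtain H where H: "H holomorphic_on ball 0 1"
    "\<And>s. cmod s < 1 \<Longrightarrow> second_difference \<phi> 0 (s *s v) = s\<^sup>2 * H s"
    "second_coeff \<phi> v = H 0"
    using second_difference_factor[OF hol zero_less_one mem] by metis
  have "cmod (second_difference \<phi> 0 (s *s v)) \<le> 2 * M" if "cmod s = r" for s
  proof -
    have "cmod (\<phi> (s *s v) + \<phi> ((- s) *s v)) \<le> M + M"
      using that r by (intro norm_triangle_mono M mem) auto
    then show ?thesis using \<open>\<phi> 0 = 0\<close> by (simp add: second_difference_def)
  qed
  from holomorphic_quotient_bound[OF H(1,2) r this, of 0] r H(3) show ?thesis by simp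
qed

text \<open>Only values on a single disc through 0 enter, so a direction inside the plane of
  \<open>V\<close> has its coefficient fixed by the polynomial. The factor 2 comes from the points
  \<open>t *s v\<close> and \<open>- t *s v\<close>.\<close>

lemma second_coeff_eq:
  assumes "\<And>t. cmod t < 1 \<Longrightarrow> \<phi> (t *s v) = t\<^sup>2 * c"
  shows "second_coeff \<phi> v = 2 * c"
proof -
  have "\<phi> 0 = 0" using assms[of 0] by simp
  then have "second_difference \<phi> 0 (t *s v) / t\<^sup>2 = 2 * c" if "t \<noteq> 0" "cmod t < 1" for t
    using that assms[of t] assms[of "- t"] by (simp add: second_difference_def)
  then have "\<forall>\<^sub>F t in at 0. 2 * c = second_difference \<phi> 0 (t *s v) / t\<^sup>2"
    unfolding eventually_at by (intro exI[of _ 1]) auto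
  then have "((\<lambda>t. second_difference \<phi> 0 (t *s v) / t\<^sup>2) \<longlongrightarrow> 2 * c) (at 0)"
    by (rule Lim_transform_eventually[OF tendsto_const])
  then show ?thesis unfolding second_coeff_def by (intro tendsto_Lim) auto
qed

section \<open>The test polynomial and its bound on the plane\<close>

definition sum_squares_cpoly :: "3 cpoly" where
  "sum_squares_cpoly = (\<Sum>i\<in>UNIV. Poly_Mapping.single (Poly_Mapping.single i 2) 1)"

lemma eval_sum_squares_cpoly: "eval_cpoly sum_squares_cpoly z = (z $ 1)\<^sup>2 + (z $ 2)\<^sup>2 + (z $ 3)\<^sup>2"
proof -
  let ?m = "\<lambda>i :: 3. Poly_Mapping.single i (2 :: nat)"
  have inj: "inj ?m"
    by (rule injI) (metis lookup_single_eq lookup_single_not_eq zero_neq_numeral)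
  have look: "Poly_Mapping.lookup sum_squares_cpoly (?m i) = 1" for i
    by (simp add: sum_squares_cpoly_def lookup_sum lookup_single when_def inj_eq[OF inj])
  have "eval_cpoly sum_squares_cpoly z = (\<Sum>m\<in>range ?m. Poly_Mapping.lookup sum_squares_cpoly m
      * (\<Prod>i\<in>UNIV. (z $ i) ^ Poly_Mapping.lookup m i))"
    unfolding eval_cpoly_def
  \<comment> \<open>An inclusion of the keys suffices, because terms outside the support have
    coefficient 0.\<close>
  proof (rule sum.mono_neutral_left)
    show "Poly_Mapping.keys sum_squares_cpoly \<subseteq> range ?m"
      unfolding sum_squares_cpoly_def by (rule order.trans[OF keys_sum]) auto
  qed (auto simp: in_keys_iff)
  also have "\<dots> = (\<Sum>j\<in>UNIV. \<Prod>i\<in>UNIV. (z $ i) ^ Poly_Mapping.lookup (?m j) i)"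
    by (simp add: sum.reindex[OF inj] look)
  also have "\<dots> = (\<Sum>j\<in>UNIV. (z $ j)\<^sup>2)"
  proof (rule sum.cong[OF refl])
    fix j :: 3
    have "(\<Prod>i\<in>UNIV. (z $ i) ^ Poly_Mapping.lookup (?m j) i) = (\<Prod>i\<in>UNIV. if i = j then (z $ j)\<^sup>2 else 1)"
      by (rule prod.cong) (auto simp: lookup_single when_def)
    then show "(\<Prod>i\<in>UNIV. (z $ i) ^ Poly_Mapping.lookup (?m j) i) = (z $ j)\<^sup>2" by simp
  qed
  finally show ?thesis by (simp add: sum_3)
qed

text \<open>On the plane the squared modulus depends only on \<open>a\<close>, \<open>b\<close>,
  \<open>c\<close>, the squared moduli of the coordinates, which lie in [0, 1]. The constant 2 is
  attained at (1, -1, 0).\<close>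

lemma cmod_sum_squares_le:
  fixes x y z :: complex
  assumes "x + y + z = 0" and "cmod x \<le> 1" "cmod y \<le> 1" "cmod z \<le> 1"
  shows "cmod (x\<^sup>2 + y\<^sup>2 + z\<^sup>2) \<le> 2"
proof -
  define a b c where "a = (cmod x)\<^sup>2" and "b = (cmod y)\<^sup>2" and "c = (cmod z)\<^sup>2"
  have z: "z = - x - y" using assms(1) by (simp add: algebra_simps eq_neg_iff_add_eq_0)
  \<comment> \<open>After \<open>z\<close> is eliminated this is a polynomial identity in the real
    and imaginary parts of \<open>x\<close> and \<open>y\<close>.\<close>
  have "(cmod (x\<^sup>2 + y\<^sup>2 + z\<^sup>2))\<^sup>2 = 2 * ((a - b)\<^sup>2 + (b - c)\<^sup>2 + (c - a)\<^sup>2)"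
    unfolding a_def b_def c_def z cmod_power2 by (simp add: power2_eq_square) algebra
  moreover have abc: "0 \<le> a" "a \<le> 1" "0 \<le> b" "b \<le> 1" "0 \<le> c" "c \<le> 1"
    using assms(2-) by (simp_all add: a_def b_def c_def power_le_one)
  have "(a - b)\<^sup>2 + (b - c)\<^sup>2 + (c - a)\<^sup>2 \<le> 2"
  proof -
    \<comment> \<open>For ordered arguments the sum equals
      \<open>2 * (p - s)\<^sup>2 - 2 * (p - q) * (q - s)\<close>. The six orderings of
      \<open>a\<close>, \<open>b\<close>, \<open>c\<close> are then covered one by one.\<close>
    have *: "(p - q)\<^sup>2 + (q - s)\<^sup>2 + (s - p)\<^sup>2 \<le> 2" if "s \<le> q" "q \<le> p" "0 \<le> s" "p \<le> 1" for p q s :: real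
    proof -
      have "(p - s)\<^sup>2 \<le> 1\<^sup>2" using that by (intro power_mono) auto
      moreover have "0 \<le> (p - q) * (q - s)" using that by simp
      ultimately show ?thesis by (simp add: power2_eq_square algebra_simps)
    qed
    show ?thesis
      using *[of a b c] *[of a c b] *[of b a c] *[of b c a] *[of c a b] *[of c b a] abc
      by (smt (verit) power2_commute)
  qed
  ultimately have "(cmod (x\<^sup>2 + y\<^sup>2 + z\<^sup>2))\<^sup>2 \<le> 2\<^sup>2" by simp
  then show ?thesis by (rule power2_le_imp_le) simp
qed

section \<open>Incompatible values of the quadratic part\<close>

lemma no_extension_of_sum_squares:
  fixes \<phi> :: "complex ^ 3 \<Rightarrow> complex"
  assumes hol: "holomorphic_several_on \<phi> polydisc" and M: "\<And>z. z \<in> polydisc \<Longrightarrow> cmod (\<phi> z) \<le> 2"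
    and ext: "\<And>z. z \<in> polydisc \<Longrightarrow> z $ 1 + z $ 2 + z $ 3 = 0 \<Longrightarrow> \<phi> z = (z $ 1)\<^sup>2 + (z $ 2)\<^sup>2 + (z $ 3)\<^sup>2"
  shows False
proof -
  have 0: "0 \<in> (polydisc :: (complex ^ 3) set)" by (simp add: polydisc_def)
  then have \<phi>0: "\<phi> 0 = 0" using ext[of 0] by simp
  \<comment> \<open>Real parts suffice for the contradiction and make it a matter of linear real
    arithmetic.\<close>
  define q where "q = (\<lambda>a b c. Re (second_coeff \<phi> (vector [a, b, c])))"
  have vec: "vector [a, b, c] + vector [a', b', c'] = (vector [a + a', b + b', c + c'] :: complex ^ 3)"
    "vector [a, b, c] - vector [a', b', c'] = (vector [a - a', b - b', c - c'] :: complex ^ 3)"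
    "- vector [a, b, c] = (vector [- a, - b, - c] :: complex ^ 3)"
    for a b c a' b' c' :: complex
    by (simp_all add: vec_eq_iff forall_3)
  have par: "q (a + a') (b + b') (c + c') + q (a - a') (b - b') (c - c') = 2 * q a b c + 2 * q a' b' c'"
    for a b c a' b' c'
    using arg_cong[OF second_coeff_parallelogram[OF hol 0, of "vector [a, b, c]" "vector [a', b', c']"], of Re]
    by (simp add: q_def vec)
  have neg: "q (- a) (- b) (- c) = q a b c" for a b c
    using second_coeff_minus[of \<phi> "vector [a, b, c]"] by (simp add: q_def vec)
  have component_le: "cmod ((vector [a, b, c] :: complex ^ 3) $ i) \<le> 1"
    if "cmod a \<le> 1" "cmod b \<le> 1" "cmod c \<le> 1" for a b c i
    using that exhaust_3[of i] by auto
  have plane: "q a b c = 4"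
    if "a + b + c = 0" "a\<^sup>2 + b\<^sup>2 + c\<^sup>2 = 2" "cmod a \<le> 1" "cmod b \<le> 1" "cmod c \<le> 1" for a b c
  proof -
    \<comment> \<open>The disc of multiples of the vector lies in \<open>V\<close>, where
      \<open>\<phi>\<close> is prescribed.\<close>
    have "\<phi> (t *s vector [a, b, c]) = t\<^sup>2 * 2" if "cmod t < 1" for t
    proof -
      have "t *s vector [a, b, c] \<in> (polydisc :: (complex ^ 3) set)"
        using that \<open>cmod a \<le> 1\<close> \<open>cmod b \<le> 1\<close> \<open>cmod c \<le> 1\<close>
        by (intro scaleC_vec_in_polydisc component_le) simp_all
      then have "\<phi> (t *s vector [a, b, c]) = (t * a)\<^sup>2 + (t * b)\<^sup>2 + (t * c)\<^sup>2"
        using ext \<open>a + b + c = 0\<close> by (simp flip: distrib_left)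
      also have "\<dots> = t\<^sup>2 * (a\<^sup>2 + b\<^sup>2 + c\<^sup>2)" by (simp add: power_mult_distrib distrib_left)
      finally show ?thesis using \<open>a\<^sup>2 + b\<^sup>2 + c\<^sup>2 = 2\<close> by simp
    qed
    from second_coeff_eq[of \<phi>, OF this] show ?thesis by (simp add: q_def)
  qed
  \<comment> \<open>The radius 19/20 gives 1600/361 in place of 4; any \<open>r\<close> with \<open>r\<^sup>2 > 5/6\<close> would do.\<close>
  have bound: "\<bar>q a b c\<bar> \<le> 1600 / 361" if "cmod a \<le> 1" "cmod b \<le> 1" "cmod c \<le> 1" for a b c
  proof -
    have "cmod (second_coeff \<phi> (vector [a, b, c])) \<le> 1600 / 361"
      using second_coeff_bound[OF hol M \<phi>0 component_le[OF that], of "19/20"]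
      by (simp add: power2_eq_square)
    then show ?thesis unfolding q_def using abs_Re_le_cmod order.trans by blast
  qed
  have "q 1 (-1) 0 = 4" "q 1 0 (-1) = 4" "q 0 1 (-1) = 4" by (simp_all add: plane)
  \<comment> \<open>The arguments of \<open>par\<close> alternate between the two vectors:
    \<open>a\<close>, \<open>a'\<close>, \<open>b\<close>, \<open>b'\<close>, \<open>c\<close>,
    \<open>c'\<close>. Let \<open>S\<close>, \<open>P\<close>, \<open>T\<close> be the sums of
    \<open>q\<close> over the \<open>e_i\<close>, over the \<open>e_i + e_j\<close>, and over the
    three vectors on the left. Using \<open>neg\<close> for opposite vectors, the rows add up to
    \<open>3 * q 1 1 1 + T = 2 * P + 2 * S\<close>, \<open>2 * T = 24 + 2 * S\<close> and
    \<open>P + 12 = 4 * S\<close>. Eliminate \<open>P\<close> and \<open>S\<close>.\<close>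
  then have "3 * (q 1 1 (-1) + q 1 (-1) 1 + q (-1) 1 1) = 48 + q 1 1 1"
    using par[of 1 0 1 0 0 1] par[of 1 0 0 1 1 0] par[of 0 1 1 0 1 0]
      par[of 1 0 "-1" 0 0 1] par[of 1 0 0 1 "-1" 0] par[of 0 1 1 0 "-1" 0]
      par[of 1 0 0 1 0 0] par[of 1 0 0 0 0 1] par[of 0 0 1 0 0 1]
      neg[of 1 1 "-1"] neg[of 1 "-1" 1] neg[of "-1" 1 1]
    by simp
  moreover have "- q 1 1 1 \<le> 1600 / 361"
    by (rule abs_le_D2, rule bound) simp_all
  moreover have "q 1 1 (-1) \<le> 1600 / 361" "q 1 (-1) 1 \<le> 1600 / 361" "q (-1) 1 1 \<le> 1600 / 361"
    by (rule abs_le_D1, rule bound; simp)+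
  ultimately show False by (simp add: field_simps)
qed

text \<open>Equality of the two suprema turns the bound 2 on \<open>V\<close> into a bound for
  \<open>\<phi>\<close> on the whole polydisc.\<close>

lemma not_polynomial_extension_property:
  "\<not> polynomial_extension_property {z \<in> polydisc. z $ 1 + z $ 2 + z $ 3 = 0}" (is "\<not> polynomial_extension_property ?V")
proof
  assume "polynomial_extension_property ?V"
  then obtain \<phi> where \<phi>: "holomorphic_several_on \<phi> polydisc" "bounded (\<phi> ` polydisc)"
    "\<And>z. z \<in> ?V \<Longrightarrow> \<phi> z = (z $ 1)\<^sup>2 + (z $ 2)\<^sup>2 + (z $ 3)\<^sup>2"
    "(SUP z\<in>polydisc. cmod (\<phi> z)) = (SUP z\<in>?V. cmod ((z $ 1)\<^sup>2 + (z $ 2)\<^sup>2 + (z $ 3)\<^sup>2))"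
    unfolding polynomial_extension_property_def eval_sum_squares_cpoly[symmetric] by blast
  have "0 \<in> ?V" by (simp add: polydisc_def)
  then have "?V \<noteq> {}" by blast
  then have "(SUP z\<in>?V. cmod ((z $ 1)\<^sup>2 + (z $ 2)\<^sup>2 + (z $ 3)\<^sup>2)) \<le> 2"
    by (intro cSUP_least) (auto simp: polydisc_def less_imp_le intro!: cmod_sum_squares_le)
  \<comment> \<open>Boundedness of \<open>\<phi>\<close> is what makes the real \<open>SUP\<close>
    an actual upper bound.\<close>
  moreover have "bdd_above ((\<lambda>z. cmod (\<phi> z)) ` polydisc)"
    using \<phi>(2) by (auto simp: bounded_iff bdd_above_def)
  then have "cmod (\<phi> z) \<le> (SUP z\<in>polydisc. cmod (\<phi> z))" if "z \<in> polydisc" for z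
    using that by (intro cSUP_upper)
  ultimately have "cmod (\<phi> z) \<le> 2" if "z \<in> polydisc" for z
    using that \<phi>(4) by fastforce
  then show False using no_extension_of_sum_squares[OF \<phi>(1)] \<phi>(3) by blast
qed

section \<open>The three graph representations\<close>

theorem mainTheorem4:
  fixes V :: "(complex ^ 3) set"
  assumes "V = {z \<in> polydisc. z $ 1 + z $ 2 + z $ 3 = 0}"
  shows "\<not> polynomial_extension_property V \<and>
    (\<exists>(U\<^sub>1 :: (complex ^ 2) set) (U\<^sub>2 :: (complex ^ 2) set) (U\<^sub>3 :: (complex ^ 2) set) h\<^sub>1 h\<^sub>2 h\<^sub>3.
       (domain_several U\<^sub>1 \<and> U\<^sub>1 \<subseteq> polydisc \<and> holomorphic_several_on h\<^sub>1 U\<^sub>1 \<and> h\<^sub>1 ` U\<^sub>1 \<subseteq> ball 0 1) \<and>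
       (domain_several U\<^sub>2 \<and> U\<^sub>2 \<subseteq> polydisc \<and> holomorphic_several_on h\<^sub>2 U\<^sub>2 \<and> h\<^sub>2 ` U\<^sub>2 \<subseteq> ball 0 1) \<and>
       (domain_several U\<^sub>3 \<and> U\<^sub>3 \<subseteq> polydisc \<and> holomorphic_several_on h\<^sub>3 U\<^sub>3 \<and> h\<^sub>3 ` U\<^sub>3 \<subseteq> ball 0 1) \<and>
       V = {vector [z\<^sub>1, z\<^sub>2, h\<^sub>3 (vector [z\<^sub>1, z\<^sub>2])] | z\<^sub>1 z\<^sub>2. vector [z\<^sub>1, z\<^sub>2] \<in> U\<^sub>3} \<and>
       V = {vector [z\<^sub>1, h\<^sub>2 (vector [z\<^sub>1, z\<^sub>3]), z\<^sub>3] | z\<^sub>1 z\<^sub>3. vector [z\<^sub>1, z\<^sub>3] \<in> U\<^sub>2} \<and>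
       V = {vector [h\<^sub>1 (vector [z\<^sub>2, z\<^sub>3]), z\<^sub>2, z\<^sub>3] | z\<^sub>2 z\<^sub>3. vector [z\<^sub>2, z\<^sub>3] \<in> U\<^sub>1})"
proof -
  \<comment> \<open>The equation is symmetric in the coordinates, so one \<open>U\<close> and one
    \<open>h\<close> serve all three graphs. The last condition in \<open>U\<close> says that the
    coordinate solved for lies in the disc.\<close>
  define U :: "(complex ^ 2) set" where "U = {w \<in> polydisc. cmod (w $ 1 + w $ 2) < 1}"
  define h :: "complex ^ 2 \<Rightarrow> complex" where "h w = - (w $ 1 + w $ 2)" for w
  have "open {w :: complex ^ 2. cmod (w $ 1 + w $ 2) < 1}"
    by (intro open_Collect_less continuous_intros)
  moreover have U: "U = polydisc \<inter> {w. cmod (w $ 1 + w $ 2) < 1}" by (auto simp: U_def)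
  ultimately have "open U" using open_Int[OF open_polydisc] by simp
  \<comment> \<open>Convexity yields connectedness: \<open>U\<close> is an intersection of preimages
    of the unit disc under linear maps.\<close>
  have "convex U"
  proof -
    have "U = (\<Inter>i. (\<lambda>w. w $ i) -` ball 0 1) \<inter> (\<lambda>w. w $ 1 + w $ 2) -` ball 0 1"
      by (auto simp: U_def polydisc_def)
    moreover have "linear (\<lambda>w :: complex ^ 2. w $ i)" "linear (\<lambda>w :: complex ^ 2. w $ 1 + w $ 2)" for i
      by (auto intro!: linearI simp: algebra_simps)
    ultimately show ?thesis
      by (auto intro!: convex_Int convex_INT convex_linear_vimage convex_ball)
  qed
  then have dom: "domain_several U"
    using \<open>open U\<close> convex_connected by (auto simp: domain_several_def U_def polydisc_def intro!: exI[of _ 0])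
  \<comment> \<open>A linear map is its own derivative at every point; complex homogeneity of
    \<open>h\<close> is read off its formula.\<close>
  have "bounded_linear h"
    unfolding linear_conv_bounded_linear[symmetric]
    by (rule linearI) (simp_all add: h_def algebra_simps)
  then have hol: "holomorphic_several_on h U"
    using \<open>open U\<close> unfolding holomorphic_several_on_def
    by (auto intro!: exI[of _ h] bounded_linear_imp_has_derivative simp: h_def algebra_simps)
  have norm: "cmod (- x - y) = cmod (x + y)" for x y
    by (metis add_uminus_conv_diff minus_add_distrib norm_minus_cancel)
  have range: "h ` U \<subseteq> ball 0 1" by (auto simp: U_def h_def norm)
  have sub: "U \<subseteq> polydisc" by (auto simp: U_def)
  have memU: "vector [x, y] \<in> U \<longleftrightarrow> cmod x < 1 \<and> cmod y < 1 \<and> cmod (x + y) < 1" for x y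
    by (auto simp: U_def polydisc_def forall_2)
  have hv: "h (vector [x, y]) = - (x + y)" for x y by (simp add: h_def)
  have memV: "v \<in> V \<longleftrightarrow> cmod (v $ 1) < 1 \<and> cmod (v $ 2) < 1 \<and> cmod (v $ 3) < 1 \<and> v $ 1 + v $ 2 + v $ 3 = 0"
    for v by (auto simp: assms polydisc_def forall_3)
  have coords: "v = vector [x, y, z] \<longleftrightarrow> v $ 1 = x \<and> v $ 2 = y \<and> v $ 3 = z" for v :: "complex ^ 3" and x y z
    by (simp add: vec_eq_iff forall_3)
  have solve: "a + b + c = 0 \<longleftrightarrow> c = - (a + b)" "a + b + c = 0 \<longleftrightarrow> b = - (a + c)"
    "a + b + c = 0 \<longleftrightarrow> a = - (b + c)" for a b c :: complex
    using add_eq_0_iff[of "a + b" c] add_eq_0_iff[of "a + c" b] add_eq_0_iff[of "b + c" a]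
    by (simp_all add: add_ac)
  have graphs: "V = {vector [x, y, h (vector [x, y])] | x y. vector [x, y] \<in> U}"
    "V = {vector [x, h (vector [x, z]), z] | x z. vector [x, z] \<in> U}"
    "V = {vector [h (vector [y, z]), y, z] | y z. vector [y, z] \<in> U}"
  proof -
    show "V = {vector [x, y, h (vector [x, y])] | x y. vector [x, y] \<in> U}"
      unfolding set_eq_iff mem_Collect_eq memU memV hv coords solve(1) by (auto simp: norm)
    show "V = {vector [x, h (vector [x, z]), z] | x z. vector [x, z] \<in> U}"
      unfolding set_eq_iff mem_Collect_eq memU memV hv coords solve(2) by (auto simp: norm)
    show "V = {vector [h (vector [y, z]), y, z] | y z. vector [y, z] \<in> U}"
      unfolding set_eq_iff mem_Collect_eq memU memV hv coords solve(3) by (auto simp: norm)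
  qed
  show ?thesis
    using not_polynomial_extension_property dom sub hol range graphs unfolding assms[symmetric] by blast
qed

end
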